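(* Let $x_1,\dots,x_d\in S^n$, where $S^n$ is identified with the unit sphere in $\mathbb{R}^{n+1}$, and let $X\in\mathbb{R}^{(n+1)\times d}$ be the matrix whose columns are $x_1,\dots,x_d$. Let $m$ be an integer with $0<m<n$. Then the best approximating $(n-m)$-spheres to the data in the projection distance, i.e. the minimizers of $\sum_{j=1}^d d_p(x_j,S_N)^2$ over all linear subspaces $N\subset\mathbb{R}^{n+1}$ with $\dim N=n+1-m$, are given by $S_N$, where $N$ is the orthogonal complement of the span of (orthonormal) right singular vectors of $X^{\mathsf T}$ corresponding to its $m$ smallest singular values.
   Context: For a linear subspace $N\subset\mathbb{R}^{n+1}$, $S_N:=S^n\cap N$ (a great subsphere of dimension $\dim N-1$). For $x,v\in S^n$, the projection distance $d_p(x,v)$ is the Euclidean distance in $\mathbb{R}^{n+1}$ from $x$ to the line $\mathrm{span}(v)$; and $d_p(x,S_N):=\min_{v\in S_N}d_p(x,v)$. The right singular vectors of $X^{\mathsf T}$ are an orthonormal basis of $\mathbb{R}^{n+1}$ consisting of eigenvectors of $XX^{\mathsf T}$; the associated singular values are the square roots of the corresponding $n+1$ eigenvalues, counted with multiplicity (zeros included). If there are ties among the singular values, any choice of an orthonormal basis of singular vectors and of $m$ of them realizing the $m$ smallest singular values is allowed. *)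

theory Defs
  imports "HOL-Analysis.Analysis"
begin

definition great_subsphere :: "'a::euclidean_space set \<Rightarrow> 'a set" where
  "great_subsphere N = sphere 0 1 \<inter> N"

definition proj_dist :: "'a::euclidean_space \<Rightarrow> 'a \<Rightarrow> real" where
  "proj_dist x v = infdist x (span {v})"

text \<open>For \<open>S = great_subsphere N\<close> with \<open>N\<close> a subspace of positive dimension the infimum is a
  minimum; see \<open>proj_dist_set_attained\<close>.\<close>

definition proj_dist_set :: "'a::euclidean_space \<Rightarrow> 'a set \<Rightarrow> real" where
  "proj_dist_set x S = (INF v\<in>S. proj_dist x v)"

lemma proj_dist_unit:
  assumes "norm v = 1"
  shows "proj_dist x v = norm (x - (x \<bullet> v) *\<^sub>R v)"
proof (rule antisym)
  show "proj_dist x v \<le> norm (x - (x \<bullet> v) *\<^sub>R v)"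
    unfolding proj_dist_def dist_norm[symmetric]
    by (rule infdist_le) (simp add: span_base span_scale)
next
  have vv: "v \<bullet> v = 1" using assms by (simp add: norm_eq_1)
  have "norm (x - (x \<bullet> v) *\<^sub>R v) \<le> dist x y" if ys: "y \<in> span {v}" for y
  proof -
    obtain c where y: "y = c *\<^sub>R v" using ys unfolding span_singleton by blast
    have "(norm (x - c *\<^sub>R v))\<^sup>2 - (norm (x - (x \<bullet> v) *\<^sub>R v))\<^sup>2 = (c - x \<bullet> v)\<^sup>2"
      unfolding power2_norm_eq_inner
      by (simp add: inner_diff_left inner_diff_right vv inner_commute[of v x]
          power2_eq_square algebra_simps)
    then have "(norm (x - (x \<bullet> v) *\<^sub>R v))\<^sup>2 \<le> (norm (x - c *\<^sub>R v))\<^sup>2"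
      by (metis diff_ge_0_iff_ge zero_le_power2)
    then show ?thesis
      unfolding y dist_norm by (rule power2_le_imp_le) simp
  qed
  then show "norm (x - (x \<bullet> v) *\<^sub>R v) \<le> proj_dist x v"
    unfolding proj_dist_def infdist_def
    by (auto intro!: cINF_greatest intro: span_zero)
qed

lemma proj_dist_set_attained:
  assumes "subspace N" "0 < dim N"
  obtains v where "v \<in> great_subsphere N" "proj_dist_set x (great_subsphere N) = proj_dist x v"
    "\<And>w. w \<in> great_subsphere N \<Longrightarrow> proj_dist x v \<le> proj_dist x w"
proof -
  let ?S = "great_subsphere N"
  obtain b where b: "b \<in> N" "b \<noteq> 0"
    using assms(2) dim_eq_0[of N] by fastforce
  then have "(1 / norm b) *\<^sub>R b \<in> ?S"
    using assms(1) by (auto simp: great_subsphere_def intro: subspace_scale)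
  then have ne: "?S \<noteq> {}" by blast
  have "compact ?S"
    unfolding great_subsphere_def
    by (intro compact_Int_closed compact_sphere closed_subspace assms(1))
  moreover have "continuous_on ?S (proj_dist x)"
  proof -
    have "continuous_on ?S (\<lambda>v. norm (x - (x \<bullet> v) *\<^sub>R v))"
      by (intro continuous_intros)
    then show ?thesis
      by (rule continuous_on_eq) (simp add: proj_dist_unit great_subsphere_def)
  qed
  ultimately obtain v where v: "v \<in> ?S" "\<And>w. w \<in> ?S \<Longrightarrow> proj_dist x v \<le> proj_dist x w"
    using ne continuous_attains_inf[of ?S "proj_dist x"] by blast
  then have "proj_dist_set x ?S = proj_dist x v"
    unfolding proj_dist_set_def by (intro cInf_eq_minimum) auto
  with v that show ?thesis by blast
qed

text \<open>\<open>u\<close> is an orthonormal basis of right singular vectors of \<open>A\<close>, i.e. of eigenvectors of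
  \<open>A\<^sup>T A\<close>, and \<open>\<sigma> i\<close> is the singular value belonging to \<open>u i\<close>. There is one vector per column of
  \<open>A\<close>, so \<open>\<sigma>\<close> lists the singular values with multiplicity, zeros included.\<close>

definition right_singular_basis ::
    "real^'n^'d \<Rightarrow> ('n \<Rightarrow> real^'n) \<Rightarrow> ('n \<Rightarrow> real) \<Rightarrow> bool" where
  "right_singular_basis A u \<sigma> \<longleftrightarrow>
     (\<forall>i j. u i \<bullet> u j = (if i = j then 1 else 0)) \<and>
     span (range u) = UNIV \<and>
     (\<forall>i. \<exists>ev. (transpose A ** A) *v u i = ev *\<^sub>R u i \<and> \<sigma> i = sqrt ev)"

text \<open>The indices in \<open>I\<close> realize the \<open>m\<close> smallest values of \<open>\<sigma>\<close>; ties may be broken arbitrarily.\<close>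

definition smallest_indices :: "nat \<Rightarrow> ('n::finite \<Rightarrow> real) \<Rightarrow> 'n set \<Rightarrow> bool" where
  "smallest_indices m \<sigma> I \<longleftrightarrow> card I = m \<and> (\<forall>i\<in>I. \<forall>j\<in>- I. \<sigma> i \<le> \<sigma> j)"

end

theory Submission
  imports Defs
begin

text \<open>
  For a unit vector \<open>v \<in> N\<close> the squared distance of \<open>x\<close> to the line through \<open>v\<close> is
  \<open>\<bar>x\<bar>\<^sup>2 - (x \<bullet> v)\<^sup>2\<close>, which is least when \<open>v\<close> points along the orthogonal projection of \<open>x\<close> to
  \<open>N\<close>. The squared distance of \<open>x\<close> to the great subsphere of \<open>N\<close> is therefore the squared length of
  the projection of \<open>x\<close> to the complement of \<open>N\<close>, that is \<open>\<Sum>b\<in>B. (x \<bullet> b)\<^sup>2\<close> for any orthonormal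
  basis \<open>B\<close> of this complement (\<open>proj_dist_set_eq_orthonormal_sum\<close>). Summed over the data, the
  objective becomes the trace \<open>\<Sum>b\<in>B. b \<bullet> T b\<close> of \<open>T = X X\<^sup>T\<close> compressed to an \<open>m\<close>-dimensional
  subspace, and the theorem describes the subspaces that minimize such a trace (the Ky Fan
  principle).

  Spans of eigenvectors for the \<open>m\<close> smallest eigenvalues are minimizers
  (\<open>eigenvalue_sum_le_trace\<close>): in an eigenbasis, the trace over any orthonormal set of \<open>m\<close> vectors is
  a weighted sum of the eigenvalues with weights in \<open>[0, 1]\<close> of total \<open>m\<close>, and such a sum is
  least when the weight sits on the \<open>m\<close> smallest eigenvalues.

  Conversely, let the complement \<open>M\<close> of \<open>N\<close> minimize the trace. Choose orthonormal bases \<open>B\<close> of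
  \<open>M\<close> and \<open>C\<close> of \<open>N\<close> that diagonalize the two compressions of \<open>T\<close>
  (\<open>selfadjoint_compression_diagonal\<close>). Tilting one \<open>b \<in> B\<close> towards one \<open>c \<in> C\<close> cannot lower the
  trace, and this forces both \<open>b \<bullet> T c = 0\<close> and \<open>b \<bullet> T b \<le> c \<bullet> T c\<close>
  (\<open>trace_minimizer_optimality\<close>). The first relation makes \<open>B \<union> C\<close> an eigenbasis of \<open>T\<close>; the second
  says that \<open>B\<close> carries the smallest eigenvalues (\<open>trace_minimizer_eigenbasis\<close>). This argument
  produces the singular vectors along the way and allows for ties.
\<close>

section \<open>Orthonormal sets\<close>

definition orthonormal :: "'a::euclidean_space set \<Rightarrow> bool" where
  "orthonormal B \<longleftrightarrow> pairwise orthogonal B \<and> (\<forall>b\<in>B. norm b = 1)"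

lemma orthonormal_inner:
  assumes "orthonormal B" "b \<in> B" "c \<in> B"
  shows "b \<bullet> c = (if b = c then 1 else 0)"
  using assms by (auto simp: orthonormal_def pairwise_def orthogonal_def norm_eq_1)

lemma orthonormal_subset: "orthonormal B \<Longrightarrow> C \<subseteq> B \<Longrightarrow> orthonormal C"
  by (auto simp: orthonormal_def pairwise_def)

lemma orthonormal_independent: "orthonormal B \<Longrightarrow> independent B"
  by (rule pairwise_orthogonal_independent) (auto simp: orthonormal_def)

lemma orthonormal_finite: "orthonormal B \<Longrightarrow> finite B"
  using orthonormal_independent independent_imp_finite by blast

lemma orthonormal_card: "orthonormal B \<Longrightarrow> card B = dim (span B)"
  by (simp add: orthonormal_independent indep_card_eq_dim_span)

lemma orthonormal_Un:
  assumes "orthonormal B" "orthonormal C" "\<And>b c. b \<in> B \<Longrightarrow> c \<in> C \<Longrightarrow> b \<bullet> c = 0"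
  shows "orthonormal (B \<union> C)"
proof -
  have "c \<bullet> b = 0" if "b \<in> B" "c \<in> C" for b c
    using assms(3)[OF that] by (simp add: inner_commute)
  then show ?thesis
    using assms unfolding orthonormal_def pairwise_def orthogonal_def by auto
qed

lemma orthonormal_residual_orthogonal:
  assumes "orthonormal B" "c \<in> span B"
  shows "(x - (\<Sum>b\<in>B. (x \<bullet> b) *\<^sub>R b)) \<bullet> c = 0"
proof -
  have "orthogonal (x - (\<Sum>b\<in>B. (x \<bullet> b) *\<^sub>R b)) y" if "y \<in> B" for y
    using that assms(1) orthonormal_finite[OF assms(1)]
    by (simp add: orthogonal_def inner_diff_left inner_sum_left orthonormal_inner
        if_distrib cong: if_cong)
  then show ?thesis
    using orthogonal_to_span[OF assms(2)] unfolding orthogonal_def by blast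
qed

text \<open>Pythagoras for the splitting of \<open>x\<close> into its projection to the span of \<open>B\<close> and the residual.
  Bessel's inequality, Parseval's identity and the formula for the distance to a great subsphere are
  all read off from it.\<close>

lemma orthonormal_residual_norm:
  assumes "orthonormal B"
  shows "(norm (x - (\<Sum>b\<in>B. (x \<bullet> b) *\<^sub>R b)))\<^sup>2 = (norm x)\<^sup>2 - (\<Sum>b\<in>B. (x \<bullet> b)\<^sup>2)"
proof -
  let ?p = "\<Sum>b\<in>B. (x \<bullet> b) *\<^sub>R b"
  have "?p \<in> span B" by (intro span_sum span_scale span_base)
  then have "(x - ?p) \<bullet> ?p = 0"
    by (rule orthonormal_residual_orthogonal[OF assms])
  then have "(norm (x - ?p))\<^sup>2 = (x - ?p) \<bullet> x"
    by (simp add: power2_norm_eq_inner inner_diff_right)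
  also have "\<dots> = (norm x)\<^sup>2 - (\<Sum>b\<in>B. (x \<bullet> b)\<^sup>2)"
    unfolding inner_diff_left inner_sum_left power2_norm_eq_inner
    by (simp add: power2_eq_square inner_commute)
  finally show ?thesis .
qed

lemma orthonormal_Bessel: "orthonormal B \<Longrightarrow> (\<Sum>b\<in>B. (x \<bullet> b)\<^sup>2) \<le> (norm x)\<^sup>2"
  using orthonormal_residual_norm[of B x] zero_le_power2[of "norm (x - (\<Sum>b\<in>B. (x \<bullet> b) *\<^sub>R b))"]
  by linarith

lemma orthonormal_expansion:
  assumes "orthonormal B" "x \<in> span B"
  shows "x = (\<Sum>b\<in>B. (x \<bullet> b) *\<^sub>R b)"
proof -
  let ?p = "\<Sum>b\<in>B. (x \<bullet> b) *\<^sub>R b"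
  have "x - ?p \<in> span B" by (intro span_diff span_sum span_scale span_base assms(2))
  then have "(x - ?p) \<bullet> (x - ?p) = 0"
    by (rule orthonormal_residual_orthogonal[OF assms(1)])
  then show ?thesis by simp
qed

lemma orthonormal_Parseval:
  assumes "orthonormal B" "x \<in> span B"
  shows "(\<Sum>b\<in>B. (x \<bullet> b)\<^sup>2) = (norm x)\<^sup>2"
  using orthonormal_residual_norm[OF assms(1), of x] orthonormal_expansion[OF assms] by simp

lemma dim_orthogonal_comp:
  fixes M :: "'a::euclidean_space set"
  assumes "subspace M"
  shows "dim (M\<^sup>\<bottom>) + dim M = DIM('a)"
  using dim_subspace_orthogonal_to_vectors[OF assms subspace_UNIV]
  by (simp add: orthogonal_comp_def)

section \<open>Distance to a great subsphere\<close>

text \<open>Let \<open>q\<close> be the projection of \<open>x\<close> to \<open>N\<close>. Vectors of \<open>N\<close> only see \<open>q\<close>, so minimizing the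
  distance means maximizing \<open>(q \<bullet> v)\<^sup>2\<close> over unit vectors of \<open>N\<close>; by Cauchy--Schwarz the maximum is
  \<open>\<bar>q\<bar>\<^sup>2\<close>, and what remains of \<open>\<bar>x\<bar>\<^sup>2\<close> is the part in the span of \<open>B\<close>. Without a unit vector in
  \<open>N\<close> the infimum would range over the empty set, hence the condition on the dimension.\<close>

lemma proj_dist_set_eq_orthonormal_sum:
  fixes x :: "'a::euclidean_space"
  assumes B: "orthonormal B" and N: "N = (span B)\<^sup>\<bottom>" and "0 < dim N"
  shows "(proj_dist_set x (great_subsphere N))\<^sup>2 = (\<Sum>b\<in>B. (x \<bullet> b)\<^sup>2)"
proof -
  have sub: "subspace N" unfolding N by (rule subspace_orthogonal_comp)
  define q where "q = x - (\<Sum>b\<in>B. (x \<bullet> b) *\<^sub>R b)"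
  have qN: "q \<in> N"
    using orthonormal_residual_orthogonal[OF B, of _ x] unfolding N orthogonal_comp_def q_def
    by (auto simp: orthogonal_def inner_commute)
  have qnorm: "(norm q)\<^sup>2 = (norm x)\<^sup>2 - (\<Sum>b\<in>B. (x \<bullet> b)\<^sup>2)"
    unfolding q_def by (rule orthonormal_residual_norm[OF B])
  have xq: "x \<bullet> w = q \<bullet> w" if "w \<in> N" for w
  proof -
    have "b \<bullet> w = 0" if "b \<in> B" for b
      using \<open>w \<in> N\<close> that by (auto simp: N orthogonal_comp_def orthogonal_def span_base)
    then show ?thesis by (simp add: q_def inner_diff_left inner_sum_left)
  qed
  have dist: "(proj_dist x w)\<^sup>2 = (norm x)\<^sup>2 - (q \<bullet> w)\<^sup>2" if "w \<in> great_subsphere N" for w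
  proof -
    have w: "norm w = 1" "w \<in> N" using that by (auto simp: great_subsphere_def)
    then have "w \<bullet> w = 1" by (simp add: norm_eq_1)
    then show ?thesis
      unfolding proj_dist_unit[OF w(1)] xq[OF w(2), symmetric] power2_norm_eq_inner
      by (simp add: inner_diff_left inner_diff_right inner_commute[of w x]
          power2_eq_square algebra_simps)
  qed
  obtain v where v: "v \<in> great_subsphere N"
    "proj_dist_set x (great_subsphere N) = proj_dist x v"
    "\<And>w. w \<in> great_subsphere N \<Longrightarrow> proj_dist x v \<le> proj_dist x w"
    using proj_dist_set_attained[OF sub assms(3), of x] by blast
  have "(q \<bullet> v)\<^sup>2 = (norm q)\<^sup>2"
  proof (rule antisym)
    have "\<bar>q \<bullet> v\<bar> \<le> norm q"
      using Cauchy_Schwarz_ineq2[of q v] v(1) by (simp add: great_subsphere_def)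
    then show "(q \<bullet> v)\<^sup>2 \<le> (norm q)\<^sup>2" by (simp add: abs_le_square_iff[symmetric])
    show "(norm q)\<^sup>2 \<le> (q \<bullet> v)\<^sup>2"
    proof (cases "q = 0")
      case False
      let ?w = "(1 / norm q) *\<^sub>R q"
      have w: "?w \<in> great_subsphere N"
        using False qN sub by (auto simp: great_subsphere_def intro: subspace_scale)
      have "0 \<le> proj_dist x v" unfolding proj_dist_def by (rule infdist_nonneg)
      then have "(proj_dist x v)\<^sup>2 \<le> (proj_dist x ?w)\<^sup>2"
        using v(3)[OF w] by (intro power_mono)
      then have "(q \<bullet> ?w)\<^sup>2 \<le> (q \<bullet> v)\<^sup>2" using dist[OF w] dist[OF v(1)] by linarith
      moreover have "q \<bullet> ?w = norm q"
        using False by (simp add: power2_norm_eq_inner[symmetric] power2_eq_square)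
      ultimately show ?thesis by simp
    qed simp
  qed
  then show ?thesis using dist[OF v(1)] v(2) qnorm by simp
qed

section \<open>Variation of the quadratic form of a self-adjoint map\<close>

text \<open>Near \<open>t = 0\<close> the linear term dominates the quadratic one and changes sign unless it vanishes.\<close>

lemma linear_coeff_zero_if_nonneg:
  fixes a k :: real
  assumes "\<And>t. 0 \<le> 2 * t * a + t\<^sup>2 * k"
  shows "a = 0"
proof (rule ccontr)
  assume "a \<noteq> 0"
  \<comment> \<open>At \<open>t = - a / s\<close> the expression is \<open>(a / s)\<^sup>2 (k - 2 s)\<close>, so any positive \<open>s > k / 2\<close> gives a
    contradiction.\<close>
  define s where "s = \<bar>k\<bar> + 1"
  have s: "s > 0" "k < s * 2" by (auto simp: s_def)
  have "0 \<le> 2 * (- a / s) * a + (- a / s)\<^sup>2 * k" by (rule assms)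
  also have "\<dots> = (a\<^sup>2 / s\<^sup>2) * (k - 2 * s)"
    using s by (simp add: power2_eq_square field_simps)
  also have "\<dots> < 0"
    using \<open>a \<noteq> 0\<close> s by (intro mult_pos_neg) auto
  finally show False by simp
qed

text \<open>First- and second-order conditions on the line \<open>b + t c\<close>. If \<open>b\<close> and \<open>c\<close> are orthonormal then
  \<open>1 + t\<^sup>2\<close> is the squared length of \<open>b + t c\<close>, so the hypothesis says that \<open>b\<close> minimizes the Rayleigh
  quotient of \<open>T\<close> in the plane of \<open>b\<close> and \<open>c\<close>. The conditions are used twice: for the minimum on the
  unit sphere of a subspace, and for the minimum of the trace.\<close>

lemma rayleigh_variation:
  fixes T :: "'a::euclidean_space \<Rightarrow> 'a"
  assumes T: "linear T" and self: "\<And>v w. v \<bullet> T w = T v \<bullet> w"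
    and min: "\<And>t. (b \<bullet> T b) * (1 + t\<^sup>2) \<le> (b + t *\<^sub>R c) \<bullet> T (b + t *\<^sub>R c)"
  shows "b \<bullet> T c = 0" and "b \<bullet> T b \<le> c \<bullet> T c"
proof -
  have "(b + t *\<^sub>R c) \<bullet> T (b + t *\<^sub>R c) = b \<bullet> T b + 2 * t * (b \<bullet> T c) + t\<^sup>2 * (c \<bullet> T c)" for t
    using self[of c b] 
    by (simp add: linear_add[OF T] linear_cmul[OF T] inner_add_left inner_add_right
        power2_eq_square algebra_simps inner_commute)
  then have nonneg: "0 \<le> 2 * t * (b \<bullet> T c) + t\<^sup>2 * (c \<bullet> T c - b \<bullet> T b)" for t
    using min[of t] by (simp add: algebra_simps)
  then show zero: "b \<bullet> T c = 0" by (rule linear_coeff_zero_if_nonneg)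
  show "b \<bullet> T b \<le> c \<bullet> T c" using nonneg[of 1] zero by simp
qed

text \<open>The spectral theorem for the compression of \<open>T\<close> to \<open>S\<close>, that is, for the quadratic form of \<open>T\<close>
  restricted to \<open>S\<close>, which need not be invariant under \<open>T\<close>. A minimizer \<open>b\<close> of the form on the unit
  sphere of \<open>S\<close> satisfies \<open>b \<bullet> T c = 0\<close> for every unit \<open>c \<in> S\<close> orthogonal to it, so one continues in
  the complement of \<open>b\<close> in \<open>S\<close>.\<close>

lemma selfadjoint_compression_diagonal:
  fixes T :: "'a::euclidean_space \<Rightarrow> 'a"
  assumes T: "linear T" and self: "\<And>v w. v \<bullet> T w = T v \<bullet> w" and "subspace S"
  obtains B where "orthonormal B" "span B = S"
    "\<And>b c. b \<in> B \<Longrightarrow> c \<in> B \<Longrightarrow> b \<noteq> c \<Longrightarrow> b \<bullet> T c = 0"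
proof -
  have "\<exists>B. orthonormal B \<and> span B = S \<and> (\<forall>b\<in>B. \<forall>c\<in>B. b \<noteq> c \<longrightarrow> b \<bullet> T c = 0)"
    using \<open>subspace S\<close>
  proof (induction "dim S" arbitrary: S rule: less_induct)
    case less
    show ?case
    proof (cases "S = {0}")
      case True
      then show ?thesis by (intro exI[of _ "{}"]) (auto simp: orthonormal_def)
    next
      case False
      obtain a where "a \<in> S" "a \<noteq> 0"
        using False less.prems subspace_0 by blast
      then have "(1 / norm a) *\<^sub>R a \<in> sphere 0 1 \<inter> S"
        using less.prems by (auto intro: subspace_scale)
      then have "sphere 0 1 \<inter> S \<noteq> {}" by blast
      moreover have "compact (sphere 0 1 \<inter> S)"
        by (intro compact_Int_closed compact_sphere closed_subspace less.prems)
      moreover have "continuous_on (sphere 0 1 \<inter> S) (\<lambda>v. v \<bullet> T v)"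
        by (intro continuous_intros linear_continuous_on_compose[OF _ T])
      ultimately obtain b where b: "b \<in> sphere 0 1 \<inter> S"
        and bmin: "\<And>w. w \<in> sphere 0 1 \<inter> S \<Longrightarrow> b \<bullet> T b \<le> w \<bullet> T w"
        using continuous_attains_inf[of "sphere 0 1 \<inter> S" "\<lambda>v. v \<bullet> T v"] by blast
      have b1: "norm b = 1" "b \<in> S" "b \<bullet> b = 1" using b by (auto simp: norm_eq_1)
      have ray: "(b \<bullet> T b) * (norm y)\<^sup>2 \<le> y \<bullet> T y" if "y \<in> S" for y
      proof (cases "y = 0")
        case False
        have "b \<bullet> T b \<le> ((1 / norm y) *\<^sub>R y) \<bullet> T ((1 / norm y) *\<^sub>R y)"
          using False that less.prems by (intro bmin) (auto intro: subspace_scale)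
        then show ?thesis
          using False by (simp add: linear_cmul[OF T] power2_eq_square field_simps)
      qed (simp add: linear_0[OF T])
      define S' where "S' = S \<inter> {y. orthogonal b y}"
      have S': "subspace S'"
        unfolding S'_def by (intro subspace_inter less.prems subspace_orthogonal_to_vector)
      have "b \<notin> S'" using b1 by (auto simp: S'_def orthogonal_def)
      then have "S' \<subset> S" using b1 by (auto simp: S'_def)
      then have "dim S' < dim S"
        using dim_psubset[of S' S] S' less.prems by (simp add: span_eq_iff[THEN iffD2])
      then obtain B where B: "orthonormal B" "span B = S'"
        "\<And>b c. b \<in> B \<Longrightarrow> c \<in> B \<Longrightarrow> b \<noteq> c \<Longrightarrow> b \<bullet> T c = 0"
        using less.hyps[OF _ S'] by blast
      have bB: "b \<bullet> c = 0" "c \<in> S" if "c \<in> B" for c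
        using span_base[OF that] unfolding B(2) S'_def orthogonal_def by auto
      have off: "b \<bullet> T c = 0" if c: "c \<in> B" for c
      proof (rule rayleigh_variation(1)[OF T self])
        fix t :: real
        have "c \<bullet> c = 1" using B(1) c by (simp add: orthonormal_inner)
        then have "(norm (b + t *\<^sub>R c))\<^sup>2 = 1 + t\<^sup>2"
          using b1 bB[OF c] unfolding power2_norm_eq_inner
          by (simp add: inner_add_left inner_add_right inner_commute[of c b] power2_eq_square)
        moreover have "b + t *\<^sub>R c \<in> S"
          using b1 bB[OF c] less.prems by (intro subspace_add subspace_scale)
        ultimately show "(b \<bullet> T b) * (1 + t\<^sup>2) \<le> (b + t *\<^sub>R c) \<bullet> T (b + t *\<^sub>R c)"
          using ray by metis
      qed
      have "orthonormal ({b} \<union> B)"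
        using B(1) b1 bB by (intro orthonormal_Un) (auto simp: orthonormal_def)
      moreover have "span ({b} \<union> B) = S"
      proof
        show "span ({b} \<union> B) \<subseteq> S"
          using b1 bB less.prems by (intro span_minimal) auto
        show "S \<subseteq> span ({b} \<union> B)"
        proof
          fix y assume "y \<in> S"
          then have "y - (b \<bullet> y) *\<^sub>R b \<in> span B"
            using b1 less.prems unfolding B(2) S'_def
            by (auto simp: orthogonal_def inner_diff_right intro: subspace_diff subspace_scale)
          then have rest: "y - (b \<bullet> y) *\<^sub>R b \<in> span ({b} \<union> B)"
            using span_mono[of B "{b} \<union> B"] by blast
          have "b \<in> span ({b} \<union> B)" by (intro span_base) simp
          then have "(y - (b \<bullet> y) *\<^sub>R b) + (b \<bullet> y) *\<^sub>R b \<in> span ({b} \<union> B)"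
            by (intro span_add[OF rest] span_scale)
          then show "y \<in> span ({b} \<union> B)" by simp
        qed
      qed
      moreover have "c \<bullet> T b = 0" if "c \<in> B" for c
        using off[OF that] self[of b c] by (simp add: inner_commute)
      ultimately show ?thesis
        using B(3) off by (intro exI[of _ "{b} \<union> B"]) auto
    qed
  qed
  then show ?thesis using that by blast
qed

section \<open>Orthonormal sets minimizing the trace\<close>

text \<open>The lower half of Ky Fan's principle. The weight \<open>w i = (\<Sum>b\<in>B. (b \<bullet> u i)\<^sup>2)\<close> of \<open>ev i\<close> in the
  trace is at most 1 by Bessel's inequality for \<open>B\<close>, and by Parseval's identity for \<open>u\<close> the weights
  add up to the cardinality of \<open>B\<close>. Comparing \<open>w\<close> with the indicator function of \<open>I\<close>, relative to a
  threshold \<open>k\<close> that separates the eigenvalues inside \<open>I\<close> from those outside, gives the claim.\<close>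

lemma eigenvalue_sum_le_trace:
  fixes T :: "'a::euclidean_space \<Rightarrow> 'a" and u :: "'i::finite \<Rightarrow> 'a"
  assumes T: "linear T"
    and u: "\<And>i j. u i \<bullet> u j = (if i = j then 1 else 0)" "span (range u) = UNIV"
    and eig: "\<And>i. T (u i) = ev i *\<^sub>R u i"
    and small: "\<And>i j. i \<in> I \<Longrightarrow> j \<notin> I \<Longrightarrow> ev i \<le> ev j"
    and B: "orthonormal B" "card B = card I"
  shows "(\<Sum>i\<in>I. ev i) \<le> (\<Sum>b\<in>B. b \<bullet> T b)"
proof -
  have inj: "inj u" by (rule injI) (metis u(1) zero_neq_one)
  have ou: "orthonormal (range u)"
    using u(1) by (auto simp: orthonormal_def pairwise_def orthogonal_def norm_eq_1)
  have reindex: "(\<Sum>y\<in>range u. f y) = (\<Sum>i\<in>UNIV. f (u i))" for f :: "'a \<Rightarrow> 'b::comm_monoid_add"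
    by (simp add: sum.reindex[OF inj])
  have parseval: "(\<Sum>i\<in>UNIV. (y \<bullet> u i)\<^sup>2) = (norm y)\<^sup>2" for y
    using orthonormal_Parseval[OF ou, of y] u(2) by (simp add: reindex)
  define w where "w i = (\<Sum>b\<in>B. (b \<bullet> u i)\<^sup>2)" for i
  have w0: "0 \<le> w i" for i unfolding w_def by (intro sum_nonneg) simp
  have w1: "w i \<le> 1" for i
    using orthonormal_Bessel[OF B(1), of "u i"] u(1)[of i i]
    by (simp add: w_def power2_norm_eq_inner inner_commute)
  have quad: "b \<bullet> T b = (\<Sum>i\<in>UNIV. ev i * (b \<bullet> u i)\<^sup>2)" for b
  proof -
    have "b = (\<Sum>i\<in>UNIV. (b \<bullet> u i) *\<^sub>R u i)"
      using orthonormal_expansion[OF ou, of b] u(2) by (simp add: reindex)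
    then have "T b = (\<Sum>i\<in>UNIV. (b \<bullet> u i) *\<^sub>R ev i *\<^sub>R u i)"
      by (metis (no_types, lifting) linear_sum[OF T] linear_cmul[OF T] eig sum.cong)
    then show ?thesis
      by (simp add: inner_sum_right power2_eq_square algebra_simps)
  qed
  have trace: "(\<Sum>b\<in>B. b \<bullet> T b) = (\<Sum>i\<in>UNIV. ev i * w i)"
    unfolding quad w_def sum_distrib_left by (rule sum.swap)
  have "(\<Sum>i\<in>UNIV. w i) = (\<Sum>b\<in>B. (norm b)\<^sup>2)"
    unfolding w_def by (subst sum.swap) (simp add: parseval)
  also have "\<dots> = card I" using B by (simp add: orthonormal_def)
  finally have wsum: "(\<Sum>i\<in>UNIV. w i) = card I" .
  obtain k where k: "\<And>i. i \<in> I \<Longrightarrow> ev i \<le> k" "\<And>j. j \<notin> I \<Longrightarrow> k \<le> ev j"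
  proof (cases "I = {}")
    case True
    then show ?thesis by (intro that[of "Min (range ev)"]) auto
  next
    case False
    then show ?thesis using small
      by (intro that[of "Max (ev ` I)"]) (auto simp: Max_le_iff)
  qed
  \<comment> \<open>Inside \<open>I\<close> both factors are nonpositive, outside \<open>I\<close> both are nonnegative. As the weights and the
    indicator function have the same total, \<open>k\<close> cancels from the sum.\<close>
  have "0 \<le> (\<Sum>i\<in>UNIV. (ev i - k) * (w i - of_bool (i \<in> I)))"
  proof (rule sum_nonneg)
    fix i
    show "0 \<le> (ev i - k) * (w i - of_bool (i \<in> I))"
      using k[of i] w0[of i] w1[of i]
      by (cases "i \<in> I") (auto intro: mult_nonpos_nonpos)
  qed
  also have "\<dots> = (\<Sum>i\<in>UNIV. (ev i - k) * w i) - (\<Sum>i\<in>UNIV. if i \<in> I then ev i - k else 0)"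
    unfolding sum_subtractf[symmetric] by (intro sum.cong) (auto simp: algebra_simps)
  also have "(\<Sum>i\<in>UNIV. (ev i - k) * w i) = (\<Sum>i\<in>UNIV. ev i * w i) - k * (\<Sum>i\<in>UNIV. w i)"
    by (simp add: left_diff_distrib sum_subtractf sum_distrib_left)
  also have "(\<Sum>i\<in>UNIV. if i \<in> I then ev i - k else 0) = (\<Sum>i\<in>I. ev i) - k * card I"
    by (simp add: sum.If_cases sum_subtractf)
  finally show ?thesis using trace wsum by simp
qed

text \<open>Replacing \<open>b\<close> by the normalization \<open>z\<close> of \<open>b + t c\<close> keeps \<open>B\<close> orthonormal, since \<open>c\<close> is
  orthogonal to all of \<open>B\<close>, and changes the trace by \<open>z \<bullet> T z - b \<bullet> T b\<close>. So \<open>b\<close> minimizes the Rayleigh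
  quotient on the line \<open>b + t c\<close>.\<close>

lemma trace_minimizer_optimality:
  fixes T :: "'a::euclidean_space \<Rightarrow> 'a"
  assumes T: "linear T" and self: "\<And>v w. v \<bullet> T w = T v \<bullet> w"
    and B: "orthonormal B" and b: "b \<in> B"
    and c: "norm c = 1" "\<And>a. a \<in> B \<Longrightarrow> a \<bullet> c = 0"
    and min: "\<And>B'. orthonormal B' \<Longrightarrow> card B' = card B \<Longrightarrow>
      (\<Sum>a\<in>B. a \<bullet> T a) \<le> (\<Sum>a\<in>B'. a \<bullet> T a)"
  shows "b \<bullet> T c = 0" and "b \<bullet> T b \<le> c \<bullet> T c"
proof -
  have "(b \<bullet> T b) * (1 + t\<^sup>2) \<le> (b + t *\<^sub>R c) \<bullet> T (b + t *\<^sub>R c)" for t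
  proof -
    let ?y = "b + t *\<^sub>R c"
    define z where "z = (1 / norm ?y) *\<^sub>R ?y"
    have inner: "b \<bullet> b = 1" "c \<bullet> c = 1" "b \<bullet> c = 0"
      using orthonormal_inner[OF B b b] c b by (auto simp: norm_eq_1)
    then have ny: "(norm ?y)\<^sup>2 = 1 + t\<^sup>2"
      unfolding power2_norm_eq_inner
      by (simp add: inner_add_left inner_add_right inner_commute[of c b] power2_eq_square)
    have y0: "?y \<noteq> 0"
      using ny zero_le_power2[of t] by (metis add_pos_nonneg less_irrefl norm_zero zero_eq_power2 zero_less_one)
    have z1: "norm z = 1" using y0 by (simp add: z_def)
    have orth: "a \<bullet> z = 0" if "a \<in> B - {b}" for a
      using that c(2) orthonormal_inner[OF B _ b] by (auto simp: z_def inner_add_right)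
    have zn: "z \<notin> B - {b}" using orth[of z] z1 by (metis norm_eq_1 zero_neq_one)
    have fin: "finite B" using B by (rule orthonormal_finite)
    have "orthonormal ((B - {b}) \<union> {z})"
      using orth z1 orthonormal_subset[OF B, of "B - {b}"]
      by (intro orthonormal_Un) (auto simp: orthonormal_def)
    moreover have "card ((B - {b}) \<union> {z}) = card B"
      using fin b zn by (simp add: card.insert_remove card_Diff_singleton)
        (metis Suc_pred card_gt_0_iff empty_iff fin)
    ultimately have "(\<Sum>a\<in>B. a \<bullet> T a) \<le> (\<Sum>a\<in>(B - {b}) \<union> {z}. a \<bullet> T a)" by (rule min)
    also have "\<dots> = z \<bullet> T z + (\<Sum>a\<in>B - {b}. a \<bullet> T a)" using fin zn by simp
    finally have "b \<bullet> T b \<le> z \<bullet> T z" using fin b by (simp add: sum.remove[of B b])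
    also have "z \<bullet> T z = (?y \<bullet> T ?y) / (1 + t\<^sup>2)"
      unfolding ny[symmetric] by (simp add: z_def linear_cmul[OF T] power2_eq_square)
    finally show ?thesis
      by (simp add: pos_le_divide_eq add_pos_nonneg)
  qed
  then show "b \<bullet> T c = 0" "b \<bullet> T b \<le> c \<bullet> T c"
    using rayleigh_variation[OF T self] by blast+
qed

lemma eigenvector_if_offdiagonal_zero:
  fixes T :: "'a::euclidean_space \<Rightarrow> 'a"
  assumes "orthonormal B" "span B = UNIV" and b: "b \<in> B"
    and off: "\<And>c. c \<in> B \<Longrightarrow> c \<noteq> b \<Longrightarrow> c \<bullet> T b = 0"
  shows "T b = (b \<bullet> T b) *\<^sub>R b"
proof -
  have fin: "finite B" using assms(1) by (rule orthonormal_finite)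
  have "T b = (\<Sum>c\<in>B. (T b \<bullet> c) *\<^sub>R c)"
    using assms(2) by (intro orthonormal_expansion assms(1)) simp
  also have "\<dots> = (T b \<bullet> b) *\<^sub>R b + (\<Sum>c\<in>B - {b}. (T b \<bullet> c) *\<^sub>R c)"
    using fin b by (rule sum.remove)
  also have "(\<Sum>c\<in>B - {b}. (T b \<bullet> c) *\<^sub>R c) = 0"
    using off by (intro sum.neutral) (auto simp: inner_commute)
  finally show ?thesis by (simp add: inner_commute)
qed

text \<open>The off-diagonal entries of \<open>T\<close> in the basis \<open>B \<union> C\<close> vanish inside \<open>B\<close> and inside \<open>C\<close> because
  the compressions are diagonal, and between \<open>B\<close> and \<open>C\<close> because of minimality.\<close>

lemma trace_minimizer_eigenbasis:
  fixes T :: "'a::euclidean_space \<Rightarrow> 'a"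
  assumes T: "linear T" and self: "\<And>v w. v \<bullet> T w = T v \<bullet> w"
    and N: "subspace N"
    and min: "\<And>B B'. orthonormal B \<Longrightarrow> span B = N\<^sup>\<bottom> \<Longrightarrow> orthonormal B' \<Longrightarrow>
      card B' = card B \<Longrightarrow> (\<Sum>a\<in>B. a \<bullet> T a) \<le> (\<Sum>a\<in>B'. a \<bullet> T a)"
  obtains B C where "orthonormal (B \<union> C)" "span (B \<union> C) = UNIV" "B \<inter> C = {}"
    "span B = N\<^sup>\<bottom>"
    "\<And>a. a \<in> B \<union> C \<Longrightarrow> T a = (a \<bullet> T a) *\<^sub>R a"
    "\<And>b c. b \<in> B \<Longrightarrow> c \<in> C \<Longrightarrow> b \<bullet> T b \<le> c \<bullet> T c"
proof -
  obtain B where B: "orthonormal B" "span B = N\<^sup>\<bottom>"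
    "\<And>b c. b \<in> B \<Longrightarrow> c \<in> B \<Longrightarrow> b \<noteq> c \<Longrightarrow> b \<bullet> T c = 0"
    using selfadjoint_compression_diagonal[OF T self subspace_orthogonal_comp[of N]] by blast
  obtain C where C: "orthonormal C" "span C = N"
    "\<And>b c. b \<in> C \<Longrightarrow> c \<in> C \<Longrightarrow> b \<noteq> c \<Longrightarrow> b \<bullet> T c = 0"
    using selfadjoint_compression_diagonal[OF T self N] by blast
  have BC: "b \<bullet> c = 0" if "b \<in> B" "c \<in> C" for b c
    using span_base[OF that(1)] span_base[OF that(2)] unfolding B(2) C(2)
    by (auto simp: orthogonal_comp_def orthogonal_def inner_commute)
  have on: "orthonormal (B \<union> C)" using B(1) C(1) BC by (rule orthonormal_Un)
  have sp: "span (B \<union> C) = UNIV"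
  proof -
    have "y \<in> span (B \<union> C)" for y
    proof -
      have "y \<in> N + N\<^sup>\<bottom>" by (simp add: subspace_sum_orthogonal_comp[OF N])
      then obtain c b where "c \<in> span C" "b \<in> span B" "y = c + b"
        unfolding B(2) C(2) by (rule set_plus_elim)
      then show ?thesis
        using span_mono[of B "B \<union> C"] span_mono[of C "B \<union> C"] by (auto intro: span_add)
    qed
    then show ?thesis by blast
  qed
  have disj: "B \<inter> C = {}"
  proof -
    have False if "b \<in> B" "b \<in> C" for b
      using BC[OF that] orthonormal_inner[OF B(1) that(1) that(1)] by simp
    then show ?thesis by blast
  qed
  have opt: "b \<bullet> T c = 0" "b \<bullet> T b \<le> c \<bullet> T c" if "b \<in> B" "c \<in> C" for b c
  proof -
    have "norm c = 1" using C(1) that(2) by (simp add: orthonormal_def)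
    note opt = trace_minimizer_optimality[OF T self B(1) that(1) this]
    show "b \<bullet> T c = 0" by (rule opt(1)) (fact BC[OF _ that(2)] min[OF B(1,2)])+
    show "b \<bullet> T b \<le> c \<bullet> T c" by (rule opt(2)) (fact BC[OF _ that(2)] min[OF B(1,2)])+
  qed
  have "c \<bullet> T b = 0" if "b \<in> B" "c \<in> C" for b c
    using opt(1)[OF that] self[of b c] by (simp add: inner_commute)
  then have "a \<bullet> T a' = 0" if "a \<in> B \<union> C" "a' \<in> B \<union> C" "a \<noteq> a'" for a a'
    using that B(3) C(3) opt(1) by blast
  then have eig: "T a = (a \<bullet> T a) *\<^sub>R a" if "a \<in> B \<union> C" for a
    using that by (intro eigenvector_if_offdiagonal_zero[OF on sp])
  show ?thesis by (rule that[OF on sp disj B(2) eig opt(2)])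
qed

section \<open>The best approximating great subspheres\<close>

text \<open>The form of \<open>X X\<^sup>T\<close> in terms of the data points; on the diagonal it is the sum of the squared
  components \<open>(x j \<bullet> v)\<^sup>2\<close>, which turns the objective into a trace.\<close>

lemma gram_inner:
  fixes X :: "real^'d^'n"
  shows "v \<bullet> ((X ** transpose X) *v w) = (\<Sum>j\<in>UNIV. (column j X \<bullet> v) * (column j X \<bullet> w))"
proof -
  have "v \<bullet> ((X ** transpose X) *v w) = (transpose X *v v) \<bullet> (transpose X *v w)"
    by (metis matrix_vector_mul_assoc dot_lmul_matrix transpose_matrix_vector)
  also have "\<dots> = (\<Sum>j\<in>UNIV. (column j X \<bullet> v) * (column j X \<bullet> w))"
    unfolding inner_vec_def[of "transpose X *v v"] matrix_vector_mul_component
    by (simp add: transpose_def column_def del: transpose_matrix_vector)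
  finally show ?thesis .
qed

theorem proposition1:
  fixes n m :: nat
    and x :: "'d::finite \<Rightarrow> real^'n"
    and X :: "real^'d^'n"
    and N :: "(real^'n) set"
  assumes "CARD('n) = n + 1"
    and "\<And>j. x j \<in> sphere 0 1"
    and "\<And>j. column j X = x j"
    and "0 < m" and "m < n"
  shows "is_arg_min (\<lambda>N. \<Sum>j\<in>UNIV. (proj_dist_set (x j) (great_subsphere N))\<^sup>2)
           (\<lambda>N. subspace N \<and> dim N = n + 1 - m) N
         \<longleftrightarrow> (\<exists>u \<sigma> I. right_singular_basis (transpose X) u \<sigma> \<and> smallest_indices m \<sigma> I \<and>
                 N = (span (u ` I))\<^sup>\<bottom>)"
proof -
  define T where "T v = (X ** transpose X) *v v" for v
  define obj where "obj N = (\<Sum>j\<in>UNIV. (proj_dist_set (x j) (great_subsphere N))\<^sup>2)" for N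
  define feas where "feas N \<longleftrightarrow> subspace N \<and> dim N = n + 1 - m" for N :: "(real^'n) set"
  have T: "linear T" unfolding T_def by (rule matrix_vector_mul_linear)
  have inner_T: "v \<bullet> T w = (\<Sum>j\<in>UNIV. (x j \<bullet> v) * (x j \<bullet> w))" for v w
    unfolding T_def gram_inner assms(3) ..
  have self: "v \<bullet> T w = T v \<bullet> w" for v w
    using inner_T[of v w] inner_T[of w v] by (simp add: inner_commute mult.commute)
  have feas_span: "feas ((span B)\<^sup>\<bottom>)" if "orthonormal B" "card B = m" for B :: "(real^'n) set"
    using dim_orthogonal_comp[of "span B"] orthonormal_card[OF that(1)] that(2) assms(1)
    by (simp add: feas_def subspace_orthogonal_comp)
  have feas_pos: "0 < dim M" if "feas M" for M
    using that assms(5) by (simp add: feas_def)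
  have feas_comp: "card B = m" if "feas M" "orthonormal B" "span B = M\<^sup>\<bottom>" for B M
    using dim_orthogonal_comp[of M] orthonormal_card[OF that(2)] that assms(1,5)
    by (simp add: feas_def)
  have obj_trace: "obj ((span B)\<^sup>\<bottom>) = (\<Sum>b\<in>B. b \<bullet> T b)"
    if "orthonormal B" "card B = m" for B
  proof -
    have "obj ((span B)\<^sup>\<bottom>) = (\<Sum>j\<in>UNIV. \<Sum>b\<in>B. (x j \<bullet> b)\<^sup>2)"
      unfolding obj_def using feas_pos[OF feas_span[OF that]]
      by (simp add: proj_dist_set_eq_orthonormal_sum[OF that(1)])
    also have "\<dots> = (\<Sum>b\<in>B. b \<bullet> T b)"
      unfolding inner_T power2_eq_square by (rule sum.swap)
    finally show ?thesis .
  qed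
  have eq_comp: "M = (span B)\<^sup>\<bottom>" if "feas M" "span B = M\<^sup>\<bottom>" for B M
    using that orthogonal_comp_self[of M] by (simp add: feas_def)
  have argmin: "is_arg_min obj feas N \<longleftrightarrow> feas N \<and> (\<forall>M. feas M \<longrightarrow> obj N \<le> obj M)"
    by (simp add: is_arg_min_linorder)
  have "is_arg_min obj feas N \<longleftrightarrow>
    (\<exists>u \<sigma> I. right_singular_basis (transpose X) u \<sigma> \<and> smallest_indices m \<sigma> I \<and>
       N = (span (u ` I))\<^sup>\<bottom>)" (is "_ \<longleftrightarrow> ?R")
  proof
    assume "?R"
    then obtain u \<sigma> I where u: "right_singular_basis (transpose X) u \<sigma>"
      and I: "smallest_indices m \<sigma> I" and N: "N = (span (u ` I))\<^sup>\<bottom>" by blast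
    have uu: "u i \<bullet> u j = (if i = j then 1 else 0)" for i j
      using u by (simp add: right_singular_basis_def)
    obtain ev where ev: "\<And>i. T (u i) = ev i *\<^sub>R u i" "\<And>i. \<sigma> i = sqrt (ev i)"
      using u unfolding right_singular_basis_def T_def transpose_transpose by metis
    have ray: "u i \<bullet> T (u i) = ev i" for i by (simp add: ev(1) uu)
    have inj: "inj u" by (rule injI) (metis uu zero_neq_one)
    have uI: "orthonormal (u ` I)"
      using uu by (auto simp: orthonormal_def pairwise_def orthogonal_def norm_eq_1)
    have card: "card (u ` I) = m"
      using I card_image[OF inj_on_subset[OF inj]] by (simp add: smallest_indices_def)
    have objN: "obj N = (\<Sum>i\<in>I. ev i)"
      unfolding N obj_trace[OF uI card]
      by (simp add: sum.reindex[OF inj_on_subset[OF inj]] ray)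
    show "is_arg_min obj feas N"
      unfolding argmin
    proof (intro conjI allI impI)
      show "feas N" unfolding N by (rule feas_span[OF uI card])
      fix M assume M: "feas M"
      obtain B where B: "orthonormal B" "span B = M\<^sup>\<bottom>"
        using selfadjoint_compression_diagonal[OF T self subspace_orthogonal_comp[of M]] by metis
      have cB: "card B = m" by (rule feas_comp[OF M B])
      have "(\<Sum>i\<in>I. ev i) \<le> (\<Sum>b\<in>B. b \<bullet> T b)"
      proof (rule eigenvalue_sum_le_trace[OF T uu _ ev(1) _ B(1)])
        show "span (range u) = UNIV" using u by (simp add: right_singular_basis_def)
        show "card B = card I" using cB I by (simp add: smallest_indices_def)
        show "ev i \<le> ev j" if "i \<in> I" "j \<notin> I" for i j
          using I that by (auto simp: smallest_indices_def ev(2))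
      qed
      then show "obj N \<le> obj M"
        using objN obj_trace[OF B(1) cB] eq_comp[OF M B(2)] by simp
    qed
  next
    assume "is_arg_min obj feas N"
    then have N: "feas N" and Nmin: "\<And>M. feas M \<Longrightarrow> obj N \<le> obj M" by (auto simp: argmin)
    have min: "(\<Sum>a\<in>B. a \<bullet> T a) \<le> (\<Sum>a\<in>B'. a \<bullet> T a)"
      if B: "orthonormal B" "span B = N\<^sup>\<bottom>" and B': "orthonormal B'" "card B' = card B" for B B'
    proof -
      have cB: "card B = m" by (rule feas_comp[OF N B])
      then show ?thesis
        using Nmin[OF feas_span[OF B'(1)]] obj_trace[OF B(1) cB] obj_trace[OF B'(1)] B'(2)
          eq_comp[OF N B(2)] by simp
    qed
    have subN: "subspace N" using N by (simp add: feas_def)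
    obtain B C where BC: "orthonormal (B \<union> C)" "span (B \<union> C) = UNIV" "B \<inter> C = {}"
      and spB: "span B = N\<^sup>\<bottom>"
      and eig: "\<And>a. a \<in> B \<union> C \<Longrightarrow> T a = (a \<bullet> T a) *\<^sub>R a"
      and ord: "\<And>b c. b \<in> B \<Longrightarrow> c \<in> C \<Longrightarrow> b \<bullet> T b \<le> c \<bullet> T c"
      using trace_minimizer_eigenbasis[OF T self subN] min by blast
    have oB: "orthonormal B" using BC(1) by (rule orthonormal_subset) simp
    have "card (B \<union> C) = CARD('n)"
      using orthonormal_card[OF BC(1)] BC(2) by simp
    then obtain u where u: "bij_betw u (UNIV :: 'n set) (B \<union> C)"
      using finite_same_card_bij[of "UNIV :: 'n set" "B \<union> C"] orthonormal_finite[OF BC(1)] by auto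
    have inj: "inj u" and ran: "range u = B \<union> C" using u by (auto simp: bij_betw_def)
    have mem: "u i \<in> B \<union> C" for i using ran by blast
    define I where "I = u -` B"
    have uI: "u ` I = B" unfolding I_def using ran by auto
    define \<sigma> where "\<sigma> i = sqrt (u i \<bullet> T (u i))" for i
    have "right_singular_basis (transpose X) u \<sigma>"
      unfolding right_singular_basis_def transpose_transpose T_def[symmetric]
    proof (intro conjI allI)
      show "u i \<bullet> u j = (if i = j then 1 else 0)" for i j
        using orthonormal_inner[OF BC(1) mem[of i] mem[of j]] by (simp add: inj_eq[OF inj])
      show "span (range u) = UNIV" using ran BC(2) by simp
      show "\<exists>ev. T (u i) = ev *\<^sub>R u i \<and> \<sigma> i = sqrt ev" for i
        using eig[OF mem[of i]] unfolding \<sigma>_def by blast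
    qed
    moreover have "smallest_indices m \<sigma> I"
      unfolding smallest_indices_def
    proof (intro conjI ballI)
      show "card I = m"
        using card_image[OF inj_on_subset[OF inj], of I] uI feas_comp[OF N oB spB] by simp
      show "\<sigma> i \<le> \<sigma> j" if "i \<in> I" "j \<in> - I" for i j
      proof -
        have "u i \<in> B" "u j \<in> C" using that mem[of j] by (auto simp: I_def)
        then show ?thesis unfolding \<sigma>_def by (simp add: ord)
      qed
    qed
    moreover have "N = (span (u ` I))\<^sup>\<bottom>" unfolding uI by (rule eq_comp[OF N spB])
    ultimately show ?R by blast
  qed
  then show ?thesis unfolding obj_def feas_def .
qed

end
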